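(* Let $\mathbf{E}$ be a Euclidean space and let $F_1,F_2,\ldots,F_m \subset \mathbf{E}$ be closed sets, each prox-regular at a point $\bar x \in \bigcap_i F_i$, and having strongly regular intersection at $\bar x$. Let $k > \operatorname{cond}(F_1,F_2,\ldots,F_m|\bar x)$ be any constant. Then, starting from any point $x$ sufficiently near $\bar x$, one iteration of the method of averaged projections, $x_+ = \frac1m\sum_{i=1}^m P_{F_i}(x)$, reduces the mean-squared-distance $$f = \frac{1}{2m}\sum_{i=1}^m d_{F_i}^2$$ by a factor of at least $1-\frac{1}{k^2m}$; that is, $f(x_+) \le \left(1-\frac{1}{k^2 m}\right) f(x)$.
   Context: For a set $F \subset \mathbf{E}$, $d_F(x) = \inf\{\|z-x\| : z\in F\}$ and $P_F(x) = \operatorname{argmin}\{\|z-x\| : z \in F\}$ is the (multivalued) projection. $F$ is prox-regular at $\bar x \in F$ if $P_F$ is single-valued on a neighborhood of $\bar x$ (so for $x$ near $\bar x$, $P_F(x)$ denotes the unique nearest point). For a closed set $F$ and $\bar x \in F$, the normal cone is $N_F(\bar x) = \{ \lim_i t_i(x_i - z_i) : t_i \ge 0,\ x_i \to \bar x,\ z_i \in P_F(x_i)\}$. Closed sets $F_1,\ldots,F_m$ have strongly regular intersection at $\bar x \in \bigcap_i F_i$ if the only vectors $y_i \in N_{F_i}(\bar x)$ $(i=1,\ldots,m)$ with $\sum_i y_i = 0$ are $y_1=\cdots=y_m=0$. The condition modulus $\operatorname{cond}(F_1,\ldots,F_m|\bar x)$ is the infimum of all $k>0$ such that $\sqrt{\sum_i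 \|y_i\|^2} \le k\|\sum_i y_i\|$ whenever $y_i \in N_{F_i}(\bar x)$ for $i=1,\ldots,m$. *)

theory Defs
  imports "HOL-Analysis.Analysis"
begin

definition proj_set :: "'a::euclidean_space set \<Rightarrow> 'a \<Rightarrow> 'a set" where
  "proj_set F x = {z. is_arg_min (\<lambda>z. norm (z - x)) (\<lambda>z. z \<in> F) z}"

definition prox_regular_at :: "'a::euclidean_space set \<Rightarrow> 'a \<Rightarrow> bool" where
  "prox_regular_at F xb \<longleftrightarrow>
     xb \<in> F \<and> (\<forall>\<^sub>F x in nhds xb. \<exists>!z. z \<in> proj_set F x)"

definition normal_cone :: "'a::euclidean_space set \<Rightarrow> 'a \<Rightarrow> 'a set" where
  "normal_cone F xb =
     {v. \<exists>(t :: nat \<Rightarrow> real) X Z.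
           (\<forall>n. t n \<ge> 0) \<and> X \<longlonglongrightarrow> xb \<and> (\<forall>n. Z n \<in> proj_set F (X n)) \<and>
           (\<lambda>n. t n *\<^sub>R (X n - Z n)) \<longlonglongrightarrow> v}"

text \<open>A family of sets indexed by \<open>1, \<dots>, m\<close> is a function on \<open>nat\<close> whose
  values outside \<open>{1..m}\<close> are irrelevant.\<close>

definition strongly_regular_intersection ::
    "nat \<Rightarrow> (nat \<Rightarrow> 'a::euclidean_space set) \<Rightarrow> 'a \<Rightarrow> bool" where
  "strongly_regular_intersection m F xb \<longleftrightarrow>
     (\<forall>y. (\<forall>i\<in>{1..m}. y i \<in> normal_cone (F i) xb) \<and> (\<Sum>i=1..m. y i) = 0
          \<longrightarrow> (\<forall>i\<in>{1..m}. y i = 0))"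

text \<open>Extended-real valued, so that the infimum is \<open>\<infinity>\<close> when no \<open>k\<close> is admissible.\<close>

definition cond_modulus ::
    "nat \<Rightarrow> (nat \<Rightarrow> 'a::euclidean_space set) \<Rightarrow> 'a \<Rightarrow> ereal" where
  "cond_modulus m F xb =
     Inf {ereal k | k :: real. k > 0 \<and>
       (\<forall>y. (\<forall>i\<in>{1..m}. y i \<in> normal_cone (F i) xb) \<longrightarrow>
            sqrt (\<Sum>i=1..m. (norm (y i))\<^sup>2) \<le> k * norm (\<Sum>i=1..m. y i))}"

text \<open>\<open>the_elem\<close> returns the nearest point where the projection is
  single-valued; its value elsewhere is unspecified.\<close>

definition averaged_proj ::
    "nat \<Rightarrow> (nat \<Rightarrow> 'a::euclidean_space set) \<Rightarrow> 'a \<Rightarrow> 'a" where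
  "averaged_proj m F x = (1 / real m) *\<^sub>R (\<Sum>i=1..m. the_elem (proj_set (F i) x))"

definition mean_sq_dist ::
    "nat \<Rightarrow> (nat \<Rightarrow> 'a::euclidean_space set) \<Rightarrow> 'a \<Rightarrow> real" where
  "mean_sq_dist m F x = 1 / (2 * real m) * (\<Sum>i=1..m. (infdist x (F i))\<^sup>2)"

end

theory Submission
  imports Defs
begin

text \<open>Let \<open>p\<^sub>i\<close> be the nearest point to \<open>x\<close> in \<open>F\<^sub>i\<close> and \<open>y\<^sub>i = x - p\<^sub>i\<close>. Since \<open>x\<^sub>+\<close> is the mean of the \<open>p\<^sub>i\<close>, bounding
  the distance from \<open>x\<^sub>+\<close> to \<open>F\<^sub>i\<close> by \<open>\<parallel>x\<^sub>+ - p\<^sub>i\<parallel>\<close> and decomposing the second moment of the \<open>p\<^sub>i\<close> about \<open>x\<close> gives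
  \<open>f(x\<^sub>+) \<le> f(x) - \<parallel>x - x\<^sub>+\<parallel>\<^sup>2 / 2\<close>, where \<open>m (x - x\<^sub>+) = \<Sum>\<^sub>i y\<^sub>i\<close>. A compactness argument transfers
  the inequality defining the condition modulus from limiting normals at the reference point to
  the vectors \<open>y\<^sub>i\<close> for \<open>x\<close> nearby, so that \<open>\<Sum>\<^sub>i \<parallel>y\<^sub>i\<parallel>\<^sup>2 \<le> k\<^sup>2 \<parallel>\<Sum>\<^sub>i y\<^sub>i\<parallel>\<^sup>2\<close>.\<close>

lemma proj_setD:
  assumes "p \<in> proj_set F x"
  shows "p \<in> F" and "infdist x F = norm (x - p)"
proof -
  show p: "p \<in> F"
    using assms by (simp add: proj_set_def is_arg_min_def)
  have min: "norm (p - x) \<le> norm (z - x)" if "z \<in> F" for z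
    using assms that by (auto simp: proj_set_def is_arg_min_linorder)
  have "norm (x - p) \<le> infdist x F"
    using p min by (auto simp: infdist_def dist_norm norm_minus_commute intro!: cINF_greatest)
  with infdist_le[OF p, of x] show "infdist x F = norm (x - p)"
    by (simp add: dist_norm)
qed

text \<open>Induction over the index set: each new index refines the subsequence found so far, and
  refinement preserves the limits already secured.\<close>

lemma finite_family_convergent_subsequence:
  fixes f :: "'i \<Rightarrow> nat \<Rightarrow> 'b::heine_borel"
  assumes "finite I" and "\<And>i. i \<in> I \<Longrightarrow> bounded (range (f i))"
  obtains r where "strict_mono r" and "\<And>i. i \<in> I \<Longrightarrow> convergent (f i \<circ> r)"
proof -
  have "\<exists>r. strict_mono r \<and> (\<forall>i\<in>I. convergent (f i \<circ> r))"
    using assms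
  proof (induction I rule: finite_induct)
    case empty
    show ?case
      using strict_mono_id by blast
  next
    case (insert j I)
    then obtain r where r: "strict_mono r" "\<forall>i\<in>I. convergent (f i \<circ> r)"
      by (metis insertCI)
    have "bounded (range (f j \<circ> r))"
      using insert.prems[of j] by (auto intro: bounded_subset)
    then obtain s l where s: "strict_mono s" "(f j \<circ> r \<circ> s) \<longlonglongrightarrow> l"
      using bounded_imp_convergent_subsequence by blast
    have "convergent (f i \<circ> (r \<circ> s))" if "i \<in> insert j I" for i
      using that r(2) s convergent_subseq_convergent[of "f i \<circ> r" s]
      by (auto simp: o_assoc convergent_def)
    then show ?case
      using r(1) s(1) strict_mono_o by blast
  qed
  then show thesis
    using that by blast
qed

text \<open>The parallel axis theorem: expand \<open>c - p i = (x - p i) - (x - c)\<close>; by the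
  second identity the cross terms add up to -2n times the squared norm of \<open>x - c\<close>,
  where n is \<open>card I\<close>, and the last terms return n times it.\<close>

lemma sum_norm_diff_mean_squared:
  fixes p :: "'i \<Rightarrow> 'a::real_inner"
  assumes "finite I" and "I \<noteq> {}" and c: "c = (1 / real (card I)) *\<^sub>R sum p I"
  shows "(\<Sum>i\<in>I. (norm (c - p i))\<^sup>2) = (\<Sum>i\<in>I. (norm (x - p i))\<^sup>2) - real (card I) * (norm (x - c))\<^sup>2"
    and "(\<Sum>i\<in>I. x - p i) = real (card I) *\<^sub>R (x - c)"
proof -
  have "real (card I) \<noteq> 0"
    using assms by simp
  then show *: "(\<Sum>i\<in>I. x - p i) = real (card I) *\<^sub>R (x - c)"
    by (simp add: c sum_subtractf scaleR_right_diff_distrib sum_constant_scaleR)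
  have "(norm (c - p i))\<^sup>2 = (norm (x - p i))\<^sup>2 - 2 * ((x - c) \<bullet> (x - p i)) + (norm (x - c))\<^sup>2" for i
    by (simp add: power2_norm_eq_inner inner_diff_left inner_diff_right inner_commute)
  then have "(\<Sum>i\<in>I. (norm (c - p i))\<^sup>2)
      = (\<Sum>i\<in>I. (norm (x - p i))\<^sup>2) - 2 * ((x - c) \<bullet> (\<Sum>i\<in>I. x - p i)) + real (card I) * (norm (x - c))\<^sup>2"
    by (simp add: sum.distrib sum_subtractf[of "\<lambda>i. (norm (x - p i))\<^sup>2"] sum_distrib_left inner_sum_right)
  then show "(\<Sum>i\<in>I. (norm (c - p i))\<^sup>2)
      = (\<Sum>i\<in>I. (norm (x - p i))\<^sup>2) - real (card I) * (norm (x - c))\<^sup>2"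
    unfolding * by (simp add: power2_norm_eq_inner)
qed

lemma eventually_proj_residual_bound:
  fixes F :: "nat \<Rightarrow> 'a::euclidean_space set"
  assumes "ereal k > cond_modulus m F xb"
  shows "\<forall>\<^sub>F x in nhds xb. \<forall>p. (\<forall>i\<in>{1..m}. p i \<in> proj_set (F i) x) \<longrightarrow>
           (\<Sum>i=1..m. (norm (x - p i))\<^sup>2) \<le> k\<^sup>2 * (norm (\<Sum>i=1..m. x - p i))\<^sup>2"
    (is "eventually ?P _")
proof (rule ccontr)
  \<comment> \<open>The infimum lies strictly below \<open>k\<close>, so some admissible
    \<open>k'\<close> does too; this gap survives the limit, where strict inequalities become
    weak.\<close>
  from assms obtain k' where k': "0 < k'" "k' < k" and cone:
    "\<And>y. \<forall>i\<in>{1..m}. y i \<in> normal_cone (F i) xb \<Longrightarrow>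
       sqrt (\<Sum>i=1..m. (norm (y i))\<^sup>2) \<le> k' * norm (\<Sum>i=1..m. y i)"
    by (auto simp: cond_modulus_def Inf_less_iff)
  assume "\<not> eventually ?P (nhds xb)"
  then have "\<exists>x. dist x xb < 1 / real (Suc n) \<and> \<not> ?P x" for n
    unfolding eventually_nhds_metric by (meson divide_pos_pos of_nat_0_less_iff zero_less_Suc zero_less_one)
  then obtain X where X: "\<And>n. dist (X n) xb < 1 / real (Suc n)" "\<And>n. \<not> ?P (X n)"
    by metis
  have X_lim: "X \<longlonglongrightarrow> xb"
    by (rule metric_tendsto_imp_tendsto[OF LIMSEQ_inverse_real_of_nat])
      (use X(1) in \<open>auto simp: inverse_eq_divide less_imp_le\<close>)
  have "\<forall>n. \<exists>p. (\<forall>i\<in>{1..m}. p i \<in> proj_set (F i) (X n)) \<and>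
      k\<^sup>2 * (norm (\<Sum>i=1..m. X n - p i))\<^sup>2 < (\<Sum>i=1..m. (norm (X n - p i))\<^sup>2)"
    using X(2) unfolding not_all not_imp not_le by blast
  from choice[OF this] obtain Z where Z: "\<And>n i. i \<in> {1..m} \<Longrightarrow> Z n i \<in> proj_set (F i) (X n)"
    and fail: "\<And>n. k\<^sup>2 * (norm (\<Sum>i=1..m. X n - Z n i))\<^sup>2 < (\<Sum>i=1..m. (norm (X n - Z n i))\<^sup>2)"
    by blast
  define q where "q n = sqrt (\<Sum>i=1..m. (norm (X n - Z n i))\<^sup>2)" for n
  have q_sq: "(q n)\<^sup>2 = (\<Sum>i=1..m. (norm (X n - Z n i))\<^sup>2)" for n
    by (simp add: q_def sum_nonneg)
  \<comment> \<open>The violated bound is strict and its smaller side is nonnegative, so the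
    residuals cannot all vanish.\<close>
  have q_pos: "q n > 0" for n
    using fail[of n] unfolding q_def
    by (smt (verit) real_sqrt_gt_zero zero_le_mult_iff zero_le_power2)
  \<comment> \<open>One scale for all \<open>i\<close>: the violated inequality is homogeneous and
    so persists, and \<open>1 / q n\<close> serves as the multiplier in
    \<open>normal_cone\<close>.\<close>
  define Y where "Y i n = (1 / q n) *\<^sub>R (X n - Z n i)" for i n
  have Y_unit: "(\<Sum>i=1..m. (norm (Y i n))\<^sup>2) = 1" for n
  proof -
    have "(\<Sum>i=1..m. (norm (Y i n))\<^sup>2) = (\<Sum>i=1..m. (norm (X n - Z n i))\<^sup>2) / (q n)\<^sup>2"
      by (simp add: Y_def power_divide sum_divide_distrib)
    then show ?thesis
      unfolding q_sq[symmetric] using q_pos[of n] by simp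
  qed
  have Y_sum: "k * norm (\<Sum>i=1..m. Y i n) \<le> 1" for n
  proof -
    have "(k * norm (\<Sum>i=1..m. X n - Z n i))\<^sup>2 \<le> (q n)\<^sup>2"
      using fail[of n] by (simp add: q_sq power_mult_distrib)
    then have "k * norm (\<Sum>i=1..m. X n - Z n i) \<le> q n"
      using q_pos[of n] by (rule power2_le_imp_le[OF _ less_imp_le])
    then show ?thesis
      using q_pos[of n] by (simp add: Y_def scaleR_sum_right[symmetric])
  qed
  have "norm (Y i n) \<le> 1" if "i \<in> {1..m}" for i n
  proof -
    have "(norm (Y i n))\<^sup>2 \<le> (\<Sum>i=1..m. (norm (Y i n))\<^sup>2)"
      using that by (intro member_le_sum) auto
    then show ?thesis
      unfolding Y_unit by (simp add: power_le_one_iff)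
  qed
  then have "bounded (range (Y i))" if "i \<in> {1..m}" for i
    using that by (auto intro: boundedI[of _ 1])
  then obtain r where r: "strict_mono r" "\<And>i. i \<in> {1..m} \<Longrightarrow> convergent (Y i \<circ> r)"
    using finite_family_convergent_subsequence[of "{1..m}" Y] by blast
  define v where "v i = lim (Y i \<circ> r)" for i
  have v: "(\<lambda>n. Y i (r n)) \<longlonglongrightarrow> v i" if "i \<in> {1..m}" for i
    using r(2)[OF that] by (simp add: v_def convergent_LIMSEQ_iff o_def)
  have "v i \<in> normal_cone (F i) xb" if "i \<in> {1..m}" for i
    unfolding normal_cone_def
    using v[OF that] Z[OF that] q_pos LIMSEQ_subseq_LIMSEQ[OF X_lim r(1)]
    by (intro CollectI exI[of _ "\<lambda>n. 1 / q (r n)"] exI[of _ "X \<circ> r"] exI[of _ "\<lambda>n. Z (r n) i"])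
      (auto simp: Y_def less_imp_le)
  then have "sqrt (\<Sum>i=1..m. (norm (v i))\<^sup>2) \<le> k' * norm (\<Sum>i=1..m. v i)"
    by (intro cone) auto
  moreover have "(\<Sum>i=1..m. (norm (v i))\<^sup>2) = 1"
  proof (rule LIMSEQ_unique)
    show "(\<lambda>n. \<Sum>i=1..m. (norm (Y i (r n)))\<^sup>2) \<longlonglongrightarrow> (\<Sum>i=1..m. (norm (v i))\<^sup>2)"
      by (intro tendsto_sum tendsto_power tendsto_norm v)
  qed (simp only: Y_unit tendsto_const)
  moreover have "k * norm (\<Sum>i=1..m. v i) \<le> 1"
  proof (rule LIMSEQ_le_const2)
    show "(\<lambda>n. k * norm (\<Sum>i=1..m. Y i (r n))) \<longlonglongrightarrow> k * norm (\<Sum>i=1..m. v i)"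
      by (intro tendsto_mult tendsto_const tendsto_norm tendsto_sum v)
  qed (use Y_sum in blast)
  \<comment> \<open>Both products are compared with 1, the total squared norm of the limits. The
    second fact makes the norm of their sum positive, so it cancels and contradicts
    \<open>k' < k\<close>.\<close>
  ultimately have "k * norm (\<Sum>i=1..m. v i) \<le> k' * norm (\<Sum>i=1..m. v i)"
    and "0 < k' * norm (\<Sum>i=1..m. v i)"
    by auto
  with k' show False
    by (simp add: zero_less_mult_iff)
qed

theorem theorem8p8:
  fixes F :: "nat \<Rightarrow> 'a::euclidean_space set"
    and m :: nat and xb :: 'a and k :: real
  assumes "m \<ge> 1"
    and "\<And>i. i \<in> {1..m} \<Longrightarrow> closed (F i)"
    and "xb \<in> (\<Inter>i\<in>{1..m}. F i)"
    and "\<And>i. i \<in> {1..m} \<Longrightarrow> prox_regular_at (F i) xb"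
    and "strongly_regular_intersection m F xb"
    and "ereal k > cond_modulus m F xb"
  shows "\<forall>\<^sub>F x in nhds xb.
           mean_sq_dist m F (averaged_proj m F x)
             \<le> (1 - 1 / (k\<^sup>2 * real m)) * mean_sq_dist m F x"
proof -
  have "k > 0"
    using assms(6) by (auto simp: cond_modulus_def Inf_less_iff)
  have "\<forall>\<^sub>F x in nhds xb. \<forall>i\<in>{1..m}. \<exists>!z. z \<in> proj_set (F i) x"
    using assms(4) by (intro eventually_ball_finite) (auto simp: prox_regular_at_def)
  then show ?thesis
    using eventually_proj_residual_bound[OF assms(6)]
  proof eventually_elim
    case (elim x)
    define p where "p i = the_elem (proj_set (F i) x)" for i
    define c where "c = averaged_proj m F x"
    define S where "S = (\<Sum>i=1..m. (norm (x - p i))\<^sup>2)"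
    \<comment> \<open>\<open>the_elem\<close> is meaningful here because the projection at
      \<open>x\<close> is a singleton.\<close>
    have p: "p i \<in> proj_set (F i) x" if "i \<in> {1..m}" for i
    proof -
      from elim(1) that obtain z where "proj_set (F i) x = {z}"
        by blast
      then show ?thesis
        by (simp add: p_def)
    qed
    have c: "c = (1 / real (card {1..m})) *\<^sub>R sum p {1..m}"
      by (simp add: c_def averaged_proj_def p_def)
    have ne: "finite {1..m}" "{1..m} \<noteq> {}"
      using assms(1) by auto
    note mean = sum_norm_diff_mean_squared[OF ne c, of x]
    have "S \<le> k\<^sup>2 * (norm (\<Sum>i=1..m. x - p i))\<^sup>2"
      unfolding S_def using elim(2) p by blast
    \<comment> \<open>One factor \<open>real m\<close> is kept apart so that the bracket is exactly
      the decrease in \<open>mean(1)\<close>.\<close>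
    also have "\<dots> = k\<^sup>2 * real m * (real m * (norm (x - c))\<^sup>2)"
      unfolding mean(2) by (simp add: power_mult_distrib power2_eq_square)
    finally have "S / (k\<^sup>2 * real m) \<le> real m * (norm (x - c))\<^sup>2"
      using \<open>k > 0\<close> assms(1) by (simp add: divide_le_eq mult.commute)
    \<comment> \<open>\<open>p i\<close> is nearest to \<open>x\<close>, perhaps not to
      \<open>c\<close>, but it lies in \<open>F i\<close> and so bounds the distance from
      \<open>c\<close>.\<close>
    moreover have "(\<Sum>i=1..m. (infdist c (F i))\<^sup>2) \<le> (\<Sum>i=1..m. (norm (c - p i))\<^sup>2)"
      using infdist_le[OF proj_setD(1)[OF p]]
      by (intro sum_mono power_mono) (auto simp: dist_norm infdist_nonneg)
    ultimately have *: "(\<Sum>i=1..m. (infdist c (F i))\<^sup>2) \<le> (1 - 1 / (k\<^sup>2 * real m)) * S"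
      using mean(1) by (simp add: S_def left_diff_distrib)
    have "mean_sq_dist m F c \<le> 1 / (2 * real m) * ((1 - 1 / (k\<^sup>2 * real m)) * S)"
      unfolding mean_sq_dist_def using * by (intro mult_left_mono) auto
    also have "\<dots> = (1 - 1 / (k\<^sup>2 * real m)) * mean_sq_dist m F x"
      using proj_setD(2)[OF p] by (simp add: mean_sq_dist_def S_def mult.left_commute)
    finally show ?case
      by (simp add: c_def)
  qed
qed

end
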